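(* Let $(A,\cdot)$ be a group. Then the following data are equivalent, under the correspondence $a\circ_i b=a\cdot\gamma_i(a)(b)$, equivalently $\gamma_i(a)(b)=a^{-1}\cdot(a\circ_i b)$ (for $a,b\in A$, $i\in I$): (1) A brace block $((A,\circ_i)\mid i\in I)$ on $(A,\cdot)$. (2) A family of maps $(\gamma_i\mid i\in I)$ such that the following conditions hold: - $\gamma_i\colon(A,\cdot)\to\operatorname{Aut}(A,\cdot)$ is a group antihomomorphism for all $i\in I$. - There exists $k\in I$ such that $\gamma_k(a)=\mathrm{id}$ for all $a\in A$. - For all $i,j\in I$ and $a,b\in A$, $$\gamma_i(a)\gamma_j(b)\gamma_i(a)^{-1}=\gamma_j(\gamma_i(a)(b)).$$
   Context: A skew brace (meaning skew left brace) is a set $A$ with two group structures $(A,\cdot)$ and $(A,\circ)$ such that $a\circ(b\cdot c)=(a\circ b)\cdot a^{-1}\cdot(a\circ c)$ for all $a,b,c\in A$, where $a^{-1}$ is the inverse of $a$ in $(A,\cdot)$. A bi-skew brace is a skew brace $(A,\cdot,\circ)$ such that $(A,\circ,\cdot)$ is also a skew brace. A brace block on a set $A$ is a family $((A,\circ_i)\mid i\in I)$ of group operations $\circ_i$ on $A$ such that $(A,\circ_i,\circ_j)$ is a bi-skew brace for all $i,j\in I$. Given a group $(A,\cdot)$, a brace block on $(A,\cdot)$ is a brace block $((A,\circ_i)\mid i\in I)$ such that $(A,\circ_k)=(A,\cdot)$ for some $k\in I$. A group antihomomorphism $\gamma\colon(A,\cdot)\to\operatorname{Aut}(A,\cdot)$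 is a map with $\gamma(a\cdot b)=\gamma(b)\gamma(a)$. *)

theory Defs
  imports "HOL-Algebra.Bij"
begin

text \<open>A skew brace is given by its two groups: \<open>G\<close> is the additive group \<open>(A, \<cdot>)\<close> and
  \<open>H\<close> is the multiplicative group \<open>(A, \<circ>)\<close>.\<close>

definition skew_brace :: "('a, 'm) monoid_scheme \<Rightarrow> ('a, 'n) monoid_scheme \<Rightarrow> bool" where
  "skew_brace G H \<longleftrightarrow>
     group G \<and> group H \<and> carrier H = carrier G \<and>
     (\<forall>a\<in>carrier G. \<forall>b\<in>carrier G. \<forall>c\<in>carrier G.
        a \<otimes>\<^bsub>H\<^esub> (b \<otimes>\<^bsub>G\<^esub> c) = (a \<otimes>\<^bsub>H\<^esub> b) \<otimes>\<^bsub>G\<^esub> inv\<^bsub>G\<^esub> a \<otimes>\<^bsub>G\<^esub> (a \<otimes>\<^bsub>H\<^esub> c))"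

definition bi_skew_brace :: "('a, 'm) monoid_scheme \<Rightarrow> ('a, 'n) monoid_scheme \<Rightarrow> bool" where
  "bi_skew_brace G H \<longleftrightarrow> skew_brace G H \<and> skew_brace H G"

text \<open>The record for \<open>(A, f)\<close>. The unit is a junk value if \<open>f\<close> has no two-sided unit in \<open>A\<close>;
  then \<open>op_struct A f\<close> is not a group.\<close>

definition op_struct :: "'a set \<Rightarrow> ('a \<Rightarrow> 'a \<Rightarrow> 'a) \<Rightarrow> 'a monoid" where
  "op_struct A f =
     \<lparr>carrier = A, mult = f, one = (THE e. e \<in> A \<and> (\<forall>x\<in>A. f e x = x \<and> f x e = x))\<rparr>"

definition brace_block :: "'i set \<Rightarrow> 'a set \<Rightarrow> ('i \<Rightarrow> 'a \<Rightarrow> 'a \<Rightarrow> 'a) \<Rightarrow> bool" where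
  "brace_block I A circ \<longleftrightarrow>
     (\<forall>i\<in>I. group (op_struct A (circ i))) \<and>
     (\<forall>i\<in>I. \<forall>j\<in>I. bi_skew_brace (op_struct A (circ i)) (op_struct A (circ j)))"

text \<open>Families are taken extensional (\<open>undefined\<close> outside \<open>I\<close> and outside the carrier), so that
  equality in HOL is equality of families of operations, respectively of maps.\<close>

definition brace_blocks_on :: "'i set \<Rightarrow> ('a, 'm) monoid_scheme \<Rightarrow> ('i \<Rightarrow> 'a \<Rightarrow> 'a \<Rightarrow> 'a) set" where
  "brace_blocks_on I G =
     {circ \<in> I \<rightarrow>\<^sub>E (carrier G \<rightarrow>\<^sub>E (carrier G \<rightarrow>\<^sub>E carrier G)).
        brace_block I (carrier G) circ \<and>
        (\<exists>k\<in>I. \<forall>a\<in>carrier G. \<forall>b\<in>carrier G. circ k a b = a \<otimes>\<^bsub>G\<^esub> b)}"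

definition antihom :: "('a, 'm) monoid_scheme \<Rightarrow> ('b, 'n) monoid_scheme \<Rightarrow> ('a \<Rightarrow> 'b) set" where
  "antihom G H =
     {f \<in> carrier G \<rightarrow> carrier H.
        \<forall>a\<in>carrier G. \<forall>b\<in>carrier G. f (a \<otimes>\<^bsub>G\<^esub> b) = f b \<otimes>\<^bsub>H\<^esub> f a}"

text \<open>The elements of \<open>AutoGroup G\<close> are extensional on \<open>carrier G\<close>; its product is composition,
  with the right factor applied first.\<close>

definition gamma_families :: "'i set \<Rightarrow> ('a, 'm) monoid_scheme \<Rightarrow> ('i \<Rightarrow> 'a \<Rightarrow> 'a \<Rightarrow> 'a) set" where
  "gamma_families I G =
     {\<gamma> \<in> I \<rightarrow>\<^sub>E (carrier G \<rightarrow>\<^sub>E carrier (AutoGroup G)).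
        (\<forall>i\<in>I. \<gamma> i \<in> antihom G (AutoGroup G)) \<and>
        (\<exists>k\<in>I. \<forall>a\<in>carrier G. \<gamma> k a = (\<lambda>x\<in>carrier G. x)) \<and>
        (\<forall>i\<in>I. \<forall>j\<in>I. \<forall>a\<in>carrier G. \<forall>b\<in>carrier G.
           \<gamma> i a \<otimes>\<^bsub>AutoGroup G\<^esub> \<gamma> j b \<otimes>\<^bsub>AutoGroup G\<^esub> inv\<^bsub>AutoGroup G\<^esub> (\<gamma> i a) = \<gamma> j (\<gamma> i a b))}"

definition gammas_of ::
    "'i set \<Rightarrow> ('a, 'm) monoid_scheme \<Rightarrow> ('i \<Rightarrow> 'a \<Rightarrow> 'a \<Rightarrow> 'a) \<Rightarrow> ('i \<Rightarrow> 'a \<Rightarrow> 'a \<Rightarrow> 'a)" where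
  "gammas_of I G circ =
     (\<lambda>i\<in>I. \<lambda>a\<in>carrier G. \<lambda>b\<in>carrier G. inv\<^bsub>G\<^esub> a \<otimes>\<^bsub>G\<^esub> circ i a b)"

definition ops_of ::
    "'i set \<Rightarrow> ('a, 'm) monoid_scheme \<Rightarrow> ('i \<Rightarrow> 'a \<Rightarrow> 'a \<Rightarrow> 'a) \<Rightarrow> ('i \<Rightarrow> 'a \<Rightarrow> 'a \<Rightarrow> 'a)" where
  "ops_of I G \<gamma> =
     (\<lambda>i\<in>I. \<lambda>a\<in>carrier G. \<lambda>b\<in>carrier G. a \<otimes>\<^bsub>G\<^esub> \<gamma> i a b)"

end

theory Submission imports Defs begin

text \<open>
  The proof rests on removing the inverse from the skew brace identity. In a skew brace
  \<open>(A, \<cdot>, \<circ>)\<close> the element \<open>u = a\<^sup>-\<^sup>1 \<cdot> (a \<circ> c)\<close> is the unique solution of \<open>a \<circ> c = a \<cdot> u\<close>, so the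
  identity says: whenever \<open>a \<circ> c = a \<cdot> u\<close>, also \<open>a \<circ> (b \<cdot> c) = (a \<circ> b) \<cdot> u\<close>
  (\<open>skew_brace_iff_transfer\<close>).

  Write \<open>a \<circ>\<^sub>i b = a \<cdot> \<gamma>\<^sub>i(a)(b)\<close>. Then \<open>a \<circ>\<^sub>j c = a \<circ>\<^sub>i u\<close> means \<open>\<gamma>\<^sub>j(a)(c) = \<gamma>\<^sub>i(a)(u)\<close>, and the
  identity for the pair \<open>(\<circ>\<^sub>i, \<circ>\<^sub>j)\<close> becomes, when \<open>\<gamma>\<^sub>j(a)\<close> is additive,
  \<open>\<gamma>\<^sub>j(a)(\<gamma>\<^sub>i(b)(c)) = \<gamma>\<^sub>i(a \<cdot> \<gamma>\<^sub>j(a)(b))(u)\<close>.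

  Let \<open>k\<close> be the index of the original operation, so that \<open>\<gamma>\<^sub>k = id\<close>. The pair \<open>(\<circ>\<^sub>k, \<circ>\<^sub>i)\<close> says that
  each \<open>\<gamma>\<^sub>i(a)\<close> is additive. The pair \<open>(\<circ>\<^sub>i, \<circ>\<^sub>k)\<close> says
  \<open>\<gamma>\<^sub>i(b)(\<gamma>\<^sub>i(a)(u)) = \<gamma>\<^sub>i(a \<cdot> b)(u)\<close>, which is the antihomomorphism law. Given that law, the
  equation above for arbitrary \<open>i\<close> and \<open>j\<close> reads
  \<open>\<gamma>\<^sub>j(a) \<gamma>\<^sub>i(b) = \<gamma>\<^sub>i(\<gamma>\<^sub>j(a)(b)) \<gamma>\<^sub>j(a)\<close>, which is the conjugation law
  (\<open>gammas_of_brace_block\<close>).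

  These steps can be read backwards. It remains to see that \<open>\<circ>\<^sub>i\<close> is a group operation: the
  antihomomorphism law and the conjugation law with \<open>i = j\<close> together give
  \<open>\<gamma>\<^sub>i(a \<circ>\<^sub>i b) = \<gamma>\<^sub>i(a) \<gamma>\<^sub>i(b)\<close>, and this is associativity of \<open>\<circ>\<^sub>i\<close> (\<open>ops_of_gamma_family\<close>).
\<close>

section \<open>The skew brace identity without inverses\<close>

text \<open>
  For given \<open>a\<close> and \<open>c\<close> the only \<open>u\<close> allowed by the premise is \<open>a\<^sup>-\<^sup>1 \<cdot> (a \<circ> c)\<close>. Since the
  condition mentions the two products only, it can be used for the groups of a brace block without
  computing their units and inverses.
\<close>
lemma skew_brace_iff_transfer:
  assumes "group G" "group H" and carr: "carrier H = carrier G"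
  shows "skew_brace G H \<longleftrightarrow>
    (\<forall>a\<in>carrier G. \<forall>b\<in>carrier G. \<forall>c\<in>carrier G. \<forall>u\<in>carrier G.
       a \<otimes>\<^bsub>H\<^esub> c = a \<otimes>\<^bsub>G\<^esub> u \<longrightarrow> a \<otimes>\<^bsub>H\<^esub> (b \<otimes>\<^bsub>G\<^esub> c) = (a \<otimes>\<^bsub>H\<^esub> b) \<otimes>\<^bsub>G\<^esub> u)"
proof -
  interpret G: group G by fact
  interpret H: group H by fact
  have H_closed: "a \<otimes>\<^bsub>H\<^esub> b \<in> carrier G" if "a \<in> carrier G" "b \<in> carrier G" for a b
    using that H.m_closed carr by simp
  have u_eq: "a \<otimes>\<^bsub>H\<^esub> c = a \<otimes>\<^bsub>G\<^esub> u \<longleftrightarrow> u = inv\<^bsub>G\<^esub> a \<otimes>\<^bsub>G\<^esub> (a \<otimes>\<^bsub>H\<^esub> c)"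
    if "a \<in> carrier G" "c \<in> carrier G" "u \<in> carrier G" for a c u
    using that H_closed[of a c] by (metis G.inv_solve_left)
  have "(\<forall>u\<in>carrier G. a \<otimes>\<^bsub>H\<^esub> c = a \<otimes>\<^bsub>G\<^esub> u \<longrightarrow>
            a \<otimes>\<^bsub>H\<^esub> (b \<otimes>\<^bsub>G\<^esub> c) = (a \<otimes>\<^bsub>H\<^esub> b) \<otimes>\<^bsub>G\<^esub> u) \<longleftrightarrow>
        a \<otimes>\<^bsub>H\<^esub> (b \<otimes>\<^bsub>G\<^esub> c) = (a \<otimes>\<^bsub>H\<^esub> b) \<otimes>\<^bsub>G\<^esub> inv\<^bsub>G\<^esub> a \<otimes>\<^bsub>G\<^esub> (a \<otimes>\<^bsub>H\<^esub> c)"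
    if "a \<in> carrier G" "b \<in> carrier G" "c \<in> carrier G" for a b c
    using that H_closed[of a b] H_closed[of a c] by (auto simp: u_eq G.m_assoc)
  then show ?thesis
    unfolding skew_brace_def using assms by auto
qed

lemma brace_block_iff_transfer:
  "brace_block I A circ \<longleftrightarrow>
     (\<forall>i\<in>I. group (op_struct A (circ i))) \<and>
     (\<forall>i\<in>I. \<forall>j\<in>I. \<forall>a\<in>A. \<forall>b\<in>A. \<forall>c\<in>A. \<forall>u\<in>A.
        circ j a c = circ i a u \<longrightarrow> circ j a (circ i b c) = circ i (circ j a b) u)"
proof (cases "\<forall>i\<in>I. group (op_struct A (circ i))")
  case True
  have "skew_brace (op_struct A (circ i)) (op_struct A (circ j)) \<longleftrightarrow>
      (\<forall>a\<in>A. \<forall>b\<in>A. \<forall>c\<in>A. \<forall>u\<in>A.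
        circ j a c = circ i a u \<longrightarrow> circ j a (circ i b c) = circ i (circ j a b) u)"
    if "i \<in> I" "j \<in> I" for i j
    using skew_brace_iff_transfer[of "op_struct A (circ i)" "op_struct A (circ j)"] True that
    by (simp add: op_struct_def)
  then show ?thesis
    unfolding brace_block_def bi_skew_brace_def using True by blast
next
  case False
  then show ?thesis unfolding brace_block_def by blast
qed

text \<open>
  The unit of \<open>op_struct A f\<close> is a definite description; it picks out \<open>e\<close> because a two-sided unit
  is unique.
\<close>
lemma group_op_structI:
  assumes closed: "\<And>a b. a \<in> A \<Longrightarrow> b \<in> A \<Longrightarrow> f a b \<in> A"
    and assoc: "\<And>a b c. a \<in> A \<Longrightarrow> b \<in> A \<Longrightarrow> c \<in> A \<Longrightarrow> f (f a b) c = f a (f b c)"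
    and unit: "e \<in> A" "\<And>a. a \<in> A \<Longrightarrow> f e a = a" "\<And>a. a \<in> A \<Longrightarrow> f a e = a"
    and inverse: "\<And>a. a \<in> A \<Longrightarrow> \<exists>b\<in>A. f b a = e"
  shows "group (op_struct A f)"
proof -
  have "(THE e. e \<in> A \<and> (\<forall>x\<in>A. f e x = x \<and> f x e = x)) = e"
    by (rule the_equality) (use unit in force)+
  then show ?thesis
    by (intro groupI) (simp_all add: op_struct_def assms)
qed

section \<open>Families of antihomomorphisms, pointwise\<close>

lemma AutoGroup_mult_apply:
  assumes "p \<in> carrier (AutoGroup G)" "q \<in> carrier (AutoGroup G)" "x \<in> carrier G"
  shows "(p \<otimes>\<^bsub>AutoGroup G\<^esub> q) x = p (q x)"
  using assms by (simp add: AutoGroup_def auto_def BijGroup_def compose_def)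

lemma AutoGroup_eq_iff:
  assumes "p \<in> carrier (AutoGroup G)" "q \<in> carrier (AutoGroup G)"
  shows "p = q \<longleftrightarrow> (\<forall>x\<in>carrier G. p x = q x)"
  using assms by (auto simp: AutoGroup_def auto_def Bij_def intro: extensionalityI)

lemma mem_AutoGroup_iff:
  "p \<in> carrier (AutoGroup G) \<longleftrightarrow>
     p \<in> hom G G \<and> p \<in> extensional (carrier G) \<and> bij_betw p (carrier G) (carrier G)"
  by (auto simp: AutoGroup_def auto_def Bij_def)

lemma (in group) antihom_AutoGroup_iff:
  assumes g: "g \<in> carrier G \<rightarrow> carrier (AutoGroup G)"
  shows "g \<in> antihom G (AutoGroup G) \<longleftrightarrow>
    (\<forall>a\<in>carrier G. \<forall>b\<in>carrier G. \<forall>x\<in>carrier G. g (a \<otimes> b) x = g b (g a x))"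
proof -
  interpret Aut: group "AutoGroup G" by (rule AutoGroup)
  have "g (a \<otimes> b) = g b \<otimes>\<^bsub>AutoGroup G\<^esub> g a \<longleftrightarrow> (\<forall>x\<in>carrier G. g (a \<otimes> b) x = g b (g a x))"
    if "a \<in> carrier G" "b \<in> carrier G" for a b
  proof -
    have mem: "g a \<in> carrier (AutoGroup G)" "g b \<in> carrier (AutoGroup G)"
      "g (a \<otimes> b) \<in> carrier (AutoGroup G)"
      using g that by (auto simp: Pi_iff)
    show ?thesis
      using AutoGroup_eq_iff[OF mem(3) Aut.m_closed[OF mem(2,1)]] mem
      by (simp add: AutoGroup_mult_apply)
  qed
  then show ?thesis using g by (auto simp: antihom_def)
qed

lemma (in group) AutoGroup_conj_eq_iff:
  assumes mem: "p \<in> carrier (AutoGroup G)" "q \<in> carrier (AutoGroup G)" "r \<in> carrier (AutoGroup G)"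
  shows "p \<otimes>\<^bsub>AutoGroup G\<^esub> q \<otimes>\<^bsub>AutoGroup G\<^esub> inv\<^bsub>AutoGroup G\<^esub> p = r \<longleftrightarrow>
    (\<forall>x\<in>carrier G. p (q x) = r (p x))"
proof -
  interpret Aut: group "AutoGroup G" by (rule AutoGroup)
  have "p \<otimes>\<^bsub>AutoGroup G\<^esub> q \<otimes>\<^bsub>AutoGroup G\<^esub> inv\<^bsub>AutoGroup G\<^esub> p = r \<longleftrightarrow>
      p \<otimes>\<^bsub>AutoGroup G\<^esub> q = r \<otimes>\<^bsub>AutoGroup G\<^esub> p"
    using mem Aut.inv_solve_right[of r "p \<otimes>\<^bsub>AutoGroup G\<^esub> q" p] by auto
  then show ?thesis
    using AutoGroup_eq_iff[OF Aut.m_closed[OF mem(1,2)] Aut.m_closed[OF mem(3,1)]] mem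
    by (simp add: AutoGroup_mult_apply)
qed

text \<open>
  Automorphisms are extensional, so equations between them can be tested at the elements of the
  group; there they can be compared directly with equations between the operations \<open>\<circ>\<^sub>i\<close>.
\<close>
lemma (in group) gamma_families_iff:
  "\<gamma> \<in> gamma_families I G \<longleftrightarrow>
     \<gamma> \<in> I \<rightarrow>\<^sub>E (carrier G \<rightarrow>\<^sub>E carrier (AutoGroup G)) \<and>
     (\<forall>i\<in>I. \<forall>a\<in>carrier G. \<forall>b\<in>carrier G. \<forall>x\<in>carrier G. \<gamma> i (a \<otimes> b) x = \<gamma> i b (\<gamma> i a x)) \<and>
     (\<exists>k\<in>I. \<forall>a\<in>carrier G. \<forall>x\<in>carrier G. \<gamma> k a x = x) \<and>
     (\<forall>i\<in>I. \<forall>j\<in>I. \<forall>a\<in>carrier G. \<forall>b\<in>carrier G. \<forall>x\<in>carrier G.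
        \<gamma> i a (\<gamma> j b x) = \<gamma> j (\<gamma> i a b) (\<gamma> i a x))"
proof (cases "\<gamma> \<in> I \<rightarrow>\<^sub>E (carrier G \<rightarrow>\<^sub>E carrier (AutoGroup G))")
  case True
  have mem: "\<gamma> i a \<in> carrier (AutoGroup G)" if "i \<in> I" "a \<in> carrier G" for i a
    using True that by (auto simp: PiE_iff)
  have closed: "\<gamma> i a b \<in> carrier G" if "i \<in> I" "a \<in> carrier G" "b \<in> carrier G" for i a b
    using mem[OF that(1,2)] that(3) by (auto simp: mem_AutoGroup_iff hom_def Pi_iff)
  have anti: "\<gamma> i \<in> antihom G (AutoGroup G) \<longleftrightarrow>
      (\<forall>a\<in>carrier G. \<forall>b\<in>carrier G. \<forall>x\<in>carrier G. \<gamma> i (a \<otimes> b) x = \<gamma> i b (\<gamma> i a x))"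
    if "i \<in> I" for i
    using mem that by (intro antihom_AutoGroup_iff) auto
  have triv: "\<gamma> k a = (\<lambda>x\<in>carrier G. x) \<longleftrightarrow> (\<forall>x\<in>carrier G. \<gamma> k a x = x)"
    if "k \<in> I" "a \<in> carrier G" for k a
    using mem[OF that] by (auto simp: mem_AutoGroup_iff intro: extensionalityI)
  have conj: "\<gamma> i a \<otimes>\<^bsub>AutoGroup G\<^esub> \<gamma> j b \<otimes>\<^bsub>AutoGroup G\<^esub> inv\<^bsub>AutoGroup G\<^esub> (\<gamma> i a) = \<gamma> j (\<gamma> i a b)
      \<longleftrightarrow> (\<forall>x\<in>carrier G. \<gamma> i a (\<gamma> j b x) = \<gamma> j (\<gamma> i a b) (\<gamma> i a x))"
    if "i \<in> I" "j \<in> I" "a \<in> carrier G" "b \<in> carrier G" for i j a b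
    using mem closed that by (intro AutoGroup_conj_eq_iff) auto
  show ?thesis
    unfolding gamma_families_def using True by (simp add: anti triv conj cong: bex_cong)
next
  case False
  then show ?thesis unfolding gamma_families_def by blast
qed

section \<open>The correspondence\<close>

text \<open>
  Bijectivity of \<open>\<gamma>\<^sub>i(a)\<close> comes from the group \<open>\<circ>\<^sub>i\<close>: left translation by \<open>a\<close> in it is \<open>\<gamma>\<^sub>i(a)\<close>
  followed by left translation by \<open>a\<close> in the original group. Additivity, the antihomomorphism law and
  the conjugation law are each one skew brace identity of the block, rewritten in terms of \<open>\<gamma>\<close> and
  with the leading factors cancelled.
\<close>
lemma (in group) gammas_of_brace_block:
  assumes circ: "circ \<in> brace_blocks_on I G"
  shows "gammas_of I G circ \<in> gamma_families I G"
proof -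
  let ?A = "carrier G"
  define \<gamma> where "\<gamma> = gammas_of I G circ"
  have grp: "group (op_struct ?A (circ i))" if "i \<in> I" for i
    using circ that by (auto simp: brace_blocks_on_def brace_block_def)
  have circ_closed: "circ i a b \<in> ?A" if "i \<in> I" "a \<in> ?A" "b \<in> ?A" for i a b
    using group.is_monoid[OF grp[OF that(1)], THEN monoid.m_closed] that
    by (simp add: op_struct_def)
  have transfer: "circ j a (circ i b c) = circ i (circ j a b) u"
    if "i \<in> I" "j \<in> I" "a \<in> ?A" "b \<in> ?A" "c \<in> ?A" "u \<in> ?A" "circ j a c = circ i a u" for i j a b c u
    using circ that unfolding brace_blocks_on_def brace_block_iff_transfer by blast
  obtain k where k: "k \<in> I" and circ_k: "\<And>a b. a \<in> ?A \<Longrightarrow> b \<in> ?A \<Longrightarrow> circ k a b = a \<otimes> b"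
    using circ by (auto simp: brace_blocks_on_def)
  have \<gamma>: "\<gamma> i a b = inv a \<otimes> circ i a b" if "i \<in> I" "a \<in> ?A" "b \<in> ?A" for i a b
    using that by (simp add: \<gamma>_def gammas_of_def)
  have closed: "\<gamma> i a b \<in> ?A" if "i \<in> I" "a \<in> ?A" "b \<in> ?A" for i a b
    using that by (simp add: \<gamma> circ_closed)
  have circ_eq: "circ i a b = a \<otimes> \<gamma> i a b" if "i \<in> I" "a \<in> ?A" "b \<in> ?A" for i a b
    using that by (simp add: \<gamma> circ_closed m_assoc[symmetric])
  have \<gamma>_k: "\<gamma> k a x = x" if "a \<in> ?A" "x \<in> ?A" for a x
    using that k by (simp add: \<gamma> circ_k m_assoc[symmetric])
  \<comment> \<open>the pair of the original operation and \<open>\<circ>\<^sub>i\<close>\<close>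
  have add: "\<gamma> i a (b \<otimes> c) = \<gamma> i a b \<otimes> \<gamma> i a c"
    if "i \<in> I" "a \<in> ?A" "b \<in> ?A" "c \<in> ?A" for i a b c
    using transfer[of k i a b c "\<gamma> i a c"] that k
    by (simp add: circ_k circ_eq[of i] closed m_assoc)
  have bij: "bij_betw (\<gamma> i a) ?A ?A" if i: "i \<in> I" and a: "a \<in> ?A" for i a
  proof (rule bij_betwI')
    interpret C: group "op_struct ?A (circ i)" by (rule grp[OF i])
    fix x y assume xy: "x \<in> ?A" "y \<in> ?A"
    have "circ i a x = circ i a y \<longleftrightarrow> x = y"
      using C.Units_l_cancel[of a x y] C.Units_eq a xy by (simp add: op_struct_def)
    then show "\<gamma> i a x = \<gamma> i a y \<longleftrightarrow> x = y"
      using i a xy by (simp add: circ_eq closed)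
  next
    fix x assume "x \<in> ?A" then show "\<gamma> i a x \<in> ?A" using closed i a by simp
  next
    interpret C: group "op_struct ?A (circ i)" by (rule grp[OF i])
    fix y assume y: "y \<in> ?A"
    define x where "x = inv\<^bsub>op_struct ?A (circ i)\<^esub> a \<otimes>\<^bsub>op_struct ?A (circ i)\<^esub> (a \<otimes> y)"
    have car: "carrier (op_struct ?A (circ i)) = ?A" by (simp add: op_struct_def)
    have x: "x \<in> ?A"
      using C.m_closed[OF C.inv_closed, of a "a \<otimes> y"] a y by (simp add: car x_def)
    have "a \<otimes>\<^bsub>op_struct ?A (circ i)\<^esub> x = a \<otimes> y"
      using C.inv_solve_left[of x a "a \<otimes> y"] a y x by (simp add: car x_def)
    then have "circ i a x = a \<otimes> y" by (simp add: op_struct_def)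
    then have "\<gamma> i a x = y" using i a x y by (simp add: circ_eq closed)
    then show "\<exists>x\<in>?A. y = \<gamma> i a x" using x by blast
  qed
  have mem: "\<gamma> \<in> I \<rightarrow>\<^sub>E (?A \<rightarrow>\<^sub>E carrier (AutoGroup G))"
    using closed add bij
    by (auto simp: mem_AutoGroup_iff hom_def PiE_iff) (auto simp: \<gamma>_def gammas_of_def)
  \<comment> \<open>the same pair in the opposite order\<close>
  have anti: "\<gamma> i (a \<otimes> b) x = \<gamma> i b (\<gamma> i a x)"
    if "i \<in> I" "a \<in> ?A" "b \<in> ?A" "x \<in> ?A" for i a b x
    using transfer[of i k a b "\<gamma> i a x" x] that k
    by (simp add: circ_k circ_eq[of i] closed m_assoc)
  have conj: "\<gamma> i a (\<gamma> j b x) = \<gamma> j (\<gamma> i a b) (\<gamma> i a x)"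
    if prems: "i \<in> I" "j \<in> I" "a \<in> ?A" "b \<in> ?A" "x \<in> ?A" for i j a b x
  proof -
    \<comment> \<open>\<open>u\<close> is chosen so that \<open>a \<circ>\<^sub>i x = a \<circ>\<^sub>j u\<close>, the premise of the transfer rule\<close>
    obtain u where u: "u \<in> ?A" "\<gamma> j a u = \<gamma> i a x"
      using bij_betw_imp_surj_on[OF bij[OF prems(2,3)]] closed[OF prems(1,3,5)] by (metis imageE)
    have "circ i a (circ j b x) = circ j (circ i a b) u"
      using prems u by (intro transfer[OF prems(2,1,3,4,5) u(1)]) (simp add: circ_eq)
    then have "\<gamma> i a (\<gamma> j b x) = \<gamma> j (a \<otimes> \<gamma> i a b) u"
      using prems u by (simp add: circ_eq closed add m_assoc)
    then show ?thesis
      using prems u by (simp add: anti closed)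
  qed
  show ?thesis
    unfolding \<gamma>_def[symmetric] gamma_families_iff
    by (intro conjI ballI bexI[OF _ k]) (fact mem anti \<gamma>_k conj)+
qed

text \<open>
  By the antihomomorphism law \<open>\<gamma>\<^sub>i(a \<cdot> \<gamma>\<^sub>i(a)(b)) = \<gamma>\<^sub>i(\<gamma>\<^sub>i(a)(b)) \<gamma>\<^sub>i(a)\<close>, which the conjugation law
  with \<open>i = j\<close> turns into \<open>\<gamma>\<^sub>i(a) \<gamma>\<^sub>i(b)\<close>. So \<open>\<gamma>\<^sub>i\<close> is multiplicative for \<open>\<circ>\<^sub>i\<close>, which makes \<open>\<circ>\<^sub>i\<close>
  associative with the old unit. The conjugation law for arbitrary \<open>i\<close> and \<open>j\<close> then yields the skew
  brace identities.
\<close>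
lemma (in group) ops_of_gamma_family:
  assumes \<gamma>: "\<gamma> \<in> gamma_families I G"
  shows "ops_of I G \<gamma> \<in> brace_blocks_on I G"
proof -
  let ?A = "carrier G"
  define circ where "circ = ops_of I G \<gamma>"
  have mem: "\<gamma> i a \<in> carrier (AutoGroup G)" if "i \<in> I" "a \<in> ?A" for i a
    using \<gamma> that by (auto simp: gamma_families_def PiE_iff)
  have closed: "\<gamma> i a b \<in> ?A" if "i \<in> I" "a \<in> ?A" "b \<in> ?A" for i a b
    using mem[OF that(1,2)] that(3) by (auto simp: mem_AutoGroup_iff hom_def Pi_iff)
  have add: "\<gamma> i a (b \<otimes> c) = \<gamma> i a b \<otimes> \<gamma> i a c"
    if "i \<in> I" "a \<in> ?A" "b \<in> ?A" "c \<in> ?A" for i a b c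
    using mem[OF that(1,2)] that(3,4) by (auto simp: mem_AutoGroup_iff hom_def)
  have bij: "bij_betw (\<gamma> i a) ?A ?A" if "i \<in> I" "a \<in> ?A" for i a
    using mem[OF that] by (simp add: mem_AutoGroup_iff)
  have anti: "\<gamma> i (a \<otimes> b) x = \<gamma> i b (\<gamma> i a x)"
    if "i \<in> I" "a \<in> ?A" "b \<in> ?A" "x \<in> ?A" for i a b x
    using \<gamma> that unfolding gamma_families_iff by blast
  have conj: "\<gamma> i a (\<gamma> j b x) = \<gamma> j (\<gamma> i a b) (\<gamma> i a x)"
    if "i \<in> I" "j \<in> I" "a \<in> ?A" "b \<in> ?A" "x \<in> ?A" for i j a b x
    using \<gamma> that unfolding gamma_families_iff by blast
  obtain k where k: "k \<in> I" and \<gamma>_k: "\<And>a x. a \<in> ?A \<Longrightarrow> x \<in> ?A \<Longrightarrow> \<gamma> k a x = x"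
    using \<gamma> unfolding gamma_families_iff by blast
  have circ: "circ i a b = a \<otimes> \<gamma> i a b" if "i \<in> I" "a \<in> ?A" "b \<in> ?A" for i a b
    using that by (simp add: circ_def ops_of_def)
  have circ_closed: "circ i a b \<in> ?A" if "i \<in> I" "a \<in> ?A" "b \<in> ?A" for i a b
    using that by (simp add: circ closed)
  have \<gamma>_one: "\<gamma> i a \<one> = \<one>" if "i \<in> I" "a \<in> ?A" for i a
    using add[OF that, of \<one> \<one>] closed[OF that, of \<one>] by simp
  have \<gamma>_at_one: "\<gamma> i \<one> x = x" if "i \<in> I" "x \<in> ?A" for i x
  proof -
    \<comment> \<open>an idempotent injection is the identity\<close>
    have "\<gamma> i \<one> (\<gamma> i \<one> x) = \<gamma> i \<one> x"
      using anti[of i \<one> \<one> x] that by simp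
    then show ?thesis
      using inj_onD[OF bij_betw_imp_inj_on[OF bij[OF that(1) one_closed]]] that closed[of i \<one> x]
      by blast
  qed
  have \<gamma>_circ: "\<gamma> i (circ i a b) x = \<gamma> i a (\<gamma> i b x)"
    if "i \<in> I" "a \<in> ?A" "b \<in> ?A" "x \<in> ?A" for i a b x
    using that by (simp add: circ anti closed conj[of i i a b x])
  have grp: "group (op_struct ?A (circ i))" if i: "i \<in> I" for i
  proof (rule group_op_structI[where e = \<one>])
    show "circ i a b \<in> ?A" if "a \<in> ?A" "b \<in> ?A" for a b
      using circ_closed i that by simp
    show "circ i (circ i a b) c = circ i a (circ i b c)"
      if "a \<in> ?A" "b \<in> ?A" "c \<in> ?A" for a b c
    proof -
      have "circ i (circ i a b) c = circ i a b \<otimes> \<gamma> i a (\<gamma> i b c)"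
        using that i by (simp add: circ[of i "circ i a b"] circ_closed \<gamma>_circ)
      then show ?thesis
        using that i by (simp add: circ closed add m_assoc)
    qed
    show "\<one> \<in> ?A" by simp
    show "circ i \<one> a = a" "circ i a \<one> = a" if "a \<in> ?A" for a
      using that i by (simp_all add: circ \<gamma>_at_one \<gamma>_one)
    show "\<exists>b\<in>?A. circ i b a = \<one>" if a: "a \<in> ?A" for a
    proof -
      \<comment> \<open>the witness \<open>\<gamma>\<^sub>i(a)\<^sup>-\<^sup>1(a\<^sup>-\<^sup>1)\<close> satisfies \<open>a \<circ>\<^sub>i b = 1\<close>; injectivity of \<open>\<gamma>\<^sub>i(a)\<close> makes it
        a left inverse as well\<close>
      obtain b where b: "b \<in> ?A" "\<gamma> i a b = inv a"
        using bij_betw_imp_surj_on[OF bij[OF i a]] a by (metis imageE inv_closed)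
      have ab: "circ i a b = \<one>" using i a b by (simp add: circ)
      have "\<gamma> i a (\<gamma> i b a) = a"
        using \<gamma>_circ[OF i a b(1) a] ab \<gamma>_at_one[OF i a] by simp
      then have "\<gamma> i a (circ i b a) = \<gamma> i a \<one>"
        using i a b by (simp add: circ closed add \<gamma>_one)
      then have "circ i b a = \<one>"
        using inj_onD[OF bij_betw_imp_inj_on[OF bij[OF i a]]] circ_closed[OF i b(1) a] by blast
      then show ?thesis using b by blast
    qed
  qed
  have transfer: "circ j a (circ i b c) = circ i (circ j a b) u"
    if ij: "i \<in> I" "j \<in> I" and abcu: "a \<in> ?A" "b \<in> ?A" "c \<in> ?A" "u \<in> ?A"
      and eq: "circ j a c = circ i a u" for i j a b c u
  proof -
    have u: "\<gamma> i a u = \<gamma> j a c" using eq ij abcu by (simp add: circ closed)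
    have "circ j a (circ i b c) = a \<otimes> \<gamma> j a b \<otimes> \<gamma> j a (\<gamma> i b c)"
      using ij abcu by (simp add: circ closed add m_assoc)
    also have "\<gamma> j a (\<gamma> i b c) = \<gamma> i (\<gamma> j a b) (\<gamma> i a u)"
      using ij abcu u conj by simp
    also have "\<dots> = \<gamma> i (a \<otimes> \<gamma> j a b) u"
      using ij abcu by (simp add: anti closed)
    finally show ?thesis using ij abcu by (simp add: circ closed)
  qed
  have "brace_block I ?A circ"
    unfolding brace_block_iff_transfer using grp transfer by blast
  moreover have "circ \<in> I \<rightarrow>\<^sub>E (?A \<rightarrow>\<^sub>E (?A \<rightarrow>\<^sub>E ?A))"
    using closed by (auto simp: circ_def ops_of_def)
  moreover have "\<forall>a\<in>?A. \<forall>b\<in>?A. circ k a b = a \<otimes> b"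
    using k by (simp add: circ \<gamma>_k)
  ultimately show ?thesis
    unfolding circ_def[symmetric] brace_blocks_on_def using k by blast
qed

lemma (in group) ops_of_gammas_of:
  assumes "circ \<in> I \<rightarrow>\<^sub>E (carrier G \<rightarrow>\<^sub>E (carrier G \<rightarrow>\<^sub>E carrier G))"
  shows "ops_of I G (gammas_of I G circ) = circ"
proof (intro ext)
  fix i a b
  show "ops_of I G (gammas_of I G circ) i a b = circ i a b"
  proof (cases "i \<in> I \<and> a \<in> carrier G \<and> b \<in> carrier G")
    case True
    then have "circ i a b \<in> carrier G" using assms by (auto simp: PiE_iff)
    with True show ?thesis by (simp add: ops_of_def gammas_of_def m_assoc[symmetric])
  next
    case False
    then show ?thesis
      using assms by (auto simp: ops_of_def PiE_iff extensional_def)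
  qed
qed

lemma (in group) gammas_of_ops_of:
  assumes "\<gamma> \<in> I \<rightarrow>\<^sub>E (carrier G \<rightarrow>\<^sub>E (carrier G \<rightarrow>\<^sub>E carrier G))"
  shows "gammas_of I G (ops_of I G \<gamma>) = \<gamma>"
proof (intro ext)
  fix i a b
  show "gammas_of I G (ops_of I G \<gamma>) i a b = \<gamma> i a b"
  proof (cases "i \<in> I \<and> a \<in> carrier G \<and> b \<in> carrier G")
    case True
    then have "\<gamma> i a b \<in> carrier G" using assms by (auto simp: PiE_iff)
    with True show ?thesis by (simp add: ops_of_def gammas_of_def m_assoc[symmetric])
  next
    case False
    then show ?thesis
      using assms by (auto simp: gammas_of_def PiE_iff extensional_def)
  qed
qed

theorem theorem6p4:
  fixes G :: "('a, 'm) monoid_scheme" and I :: "'i set"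
  assumes "group G"
  shows "bij_betw (gammas_of I G) (brace_blocks_on I G) (gamma_families I G) \<and>
         bij_betw (ops_of I G) (gamma_families I G) (brace_blocks_on I G) \<and>
         (\<forall>circ\<in>brace_blocks_on I G. ops_of I G (gammas_of I G circ) = circ) \<and>
         (\<forall>\<gamma>\<in>gamma_families I G. gammas_of I G (ops_of I G \<gamma>) = \<gamma>)"
proof -
  interpret group G by fact
  have ops_gammas: "\<forall>circ\<in>brace_blocks_on I G. ops_of I G (gammas_of I G circ) = circ"
    by (auto simp: brace_blocks_on_def intro: ops_of_gammas_of)
  have "carrier (AutoGroup G) \<subseteq> carrier G \<rightarrow>\<^sub>E carrier G"
    by (auto simp: mem_AutoGroup_iff hom_def PiE_def)
  then have "\<gamma> \<in> I \<rightarrow>\<^sub>E (carrier G \<rightarrow>\<^sub>E (carrier G \<rightarrow>\<^sub>E carrier G))" if "\<gamma> \<in> gamma_families I G" for \<gamma>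
    using that unfolding gamma_families_def by (auto simp: PiE_iff subset_iff)
  then have gammas_ops: "\<forall>\<gamma>\<in>gamma_families I G. gammas_of I G (ops_of I G \<gamma>) = \<gamma>"
    by (blast intro: gammas_of_ops_of)
  have "bij_betw (gammas_of I G) (brace_blocks_on I G) (gamma_families I G)"
    using ops_gammas gammas_ops gammas_of_brace_block ops_of_gamma_family
    by (intro bij_betw_byWitness[where f' = "ops_of I G"]) auto
  moreover have "bij_betw (ops_of I G) (gamma_families I G) (brace_blocks_on I G)"
    using ops_gammas gammas_ops gammas_of_brace_block ops_of_gamma_family
    by (intro bij_betw_byWitness[where f' = "gammas_of I G"]) auto
  ultimately show ?thesis using ops_gammas gammas_ops by blast
qed

end
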